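(* Let $\widetilde{F}:\mathbb{R}^m\to\mathbb{R}$ be $L$-smooth and bounded below, and let $L' = L+1$. Let $c_1'>0$ and $c_2'>0$ be constants, $\mathbf{z}_0\in\mathbb{R}^m$, and let $(\mathbf{z}_k)_{k\in\mathbb{N}_0}$ be generated by $\mathbf{z}_{k+1}=\mathbf{z}_k+t_k\mathbf{s}_k$ for all $k\in\mathbb{N}_0$, where $t_k>0$ and the directions $\mathbf{s}_k\in\mathbb{R}^m$ satisfy, for all $k\in\mathbb{N}_0$, $$c_1'\|\overline{\nabla}\widetilde{F}(\mathbf{z}_k)\|_2^2\le -\overline{\nabla}\widetilde{F}(\mathbf{z}_k)^T\mathbf{s}_k,\qquad \|\mathbf{s}_k\|_2\le c_2'\|\overline{\nabla}\widetilde{F}(\mathbf{z}_k)\|_2 .$$ Let $\beta\in\left[0,\frac{1}{\sqrt{L'}}\frac{c_1'}{c_2'}\right)$ and let $(\delta_k)_{k\in\mathbb{N}_0}$ be a non-negative sequence such that, for all $k\in\mathbb{N}_0$, $$\|\overline{\nabla}\widetilde{F}(\mathbf{z}_k)-\nabla\widetilde{F}(\mathbf{z}_k)\|_2\le\delta_k\qquad\text{and}\qquad \delta_k\le\beta\|\overline{\nabla}\widetilde{F}(\mathbf{z}_k)\|_2 .$$ Set $$\Delta=(c_1')^2-L'(c_2')^2\beta^2,\qquad \overline{t}_1=\frac{c_1'-\sqrt{\Delta}}{(c_2')^2L'},\qquad \overline{t}_2=\frac{c_1'+\sqrt{\Delta}}{(c_2')^2L'},$$ and let $\gamma\in\left(0,\frac{\overline{t}_2-\overline{t}_1}{2}\right]$.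 If $t_k\in[\overline{t}_1+\gamma,\ \overline{t}_2-\gamma]$ for all $k\in\mathbb{N}_0$, then: (a) $\widetilde{F}(\mathbf{z}_{k+1})\le\widetilde{F}(\mathbf{z}_k)$ for all $k\in\mathbb{N}_0$; (b) $\lim_{k\to\infty}\overline{\nabla}\widetilde{F}(\mathbf{z}_k)=\mathbf{0}$ and $\lim_{k\to\infty}\nabla\widetilde{F}(\mathbf{z}_k)=\mathbf{0}$ in $\mathbb{R}^m$. Furthermore, every limit point of $(\mathbf{z}_k)_{k\in\mathbb{N}_0}$ is a stationary point of $\widetilde{F}$.
   Context: $L$-smooth means that $\widetilde{F}$ is differentiable on $\mathbb{R}^m$ and $\|\nabla\widetilde{F}(\mathbf{x})-\nabla\widetilde{F}(\mathbf{z})\|_2\le L\|\mathbf{x}-\mathbf{z}\|_2$ for all $\mathbf{x},\mathbf{z}\in\mathbb{R}^m$, with $L\ge 0$. For each $k$, $\overline{\nabla}\widetilde{F}(\mathbf{z}_k)\in\mathbb{R}^m$ denotes the inexact gradient available at $\mathbf{z}_k$, an approximation of the exact gradient $\nabla\widetilde{F}(\mathbf{z}_k)$ about which nothing is assumed beyond the conditions in the statement. $\mathbb{N}_0=\{0,1,2,\dots\}$. A limit point of a sequence is the limit of some subsequence. A stationary point is a point where the exact gradient $\nabla\widetilde{F}$ vanishes. *)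

theory Defs
  imports "HOL-Analysis.Analysis"
begin

definition gradient :: "('a::euclidean_space \<Rightarrow> real) \<Rightarrow> 'a \<Rightarrow> 'a" where
  "gradient F x = (THE D. GDERIV F x :> D)"

lemma gradient_unique:
  fixes F :: "'a::euclidean_space \<Rightarrow> real"
  assumes "GDERIV F x :> D"
  shows "gradient F x = D"
  unfolding gradient_def
proof (rule the_equality)
  show "GDERIV F x :> D" by fact
  fix D' assume "GDERIV F x :> D'"
  then have "(\<lambda>h. h \<bullet> D') = (\<lambda>h. h \<bullet> D)"
    using assms has_derivative_unique unfolding gderiv_def by blast
  then show "D' = D"
    by (metis vector_eq_ldot)
qed

lemma GDERIV_gradient:
  fixes F :: "'a::euclidean_space \<Rightarrow> real"
  assumes "F differentiable (at x)"
  shows "GDERIV F x :> gradient F x"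
proof -
  from assms obtain F' where F': "(F has_derivative F') (at x)"
    unfolding differentiable_def by blast
  then interpret linear F' by (rule has_derivative_linear)
  have "F' h = h \<bullet> (\<Sum>b\<in>Basis. F' b *\<^sub>R b)" for h
  proof -
    have "F' h = F' (\<Sum>b\<in>Basis. (h \<bullet> b) *\<^sub>R b)"
      by (simp only: euclidean_representation)
    also have "\<dots> = (\<Sum>b\<in>Basis. (h \<bullet> b) * F' b)"
      by (simp add: sum scale)
    finally show ?thesis
      by (simp add: inner_sum_right mult.commute)
  qed
  then have "F' = (\<lambda>h. h \<bullet> (\<Sum>b\<in>Basis. F' b *\<^sub>R b))"
    by blast
  with F' have "GDERIV F x :> (\<Sum>b\<in>Basis. F' b *\<^sub>R b)"
    unfolding gderiv_def by simp
  with gradient_unique show ?thesis by metis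
qed

definition L_smooth :: "real \<Rightarrow> ('a::euclidean_space \<Rightarrow> real) \<Rightarrow> bool" where
  "L_smooth L F \<longleftrightarrow> 0 \<le> L \<and> (\<forall>x. F differentiable (at x)) \<and>
     (\<forall>x z. norm (gradient F x - gradient F z) \<le> L * norm (x - z))"

text \<open>A limit point of a sequence is a subsequential limit. This is not the library's
  \<^term>\<open>x islimpt range z\<close>: a value taken infinitely often also counts.\<close>

definition seq_limit_point :: "(nat \<Rightarrow> 'a::topological_space) \<Rightarrow> 'a \<Rightarrow> bool" where
  "seq_limit_point z x \<longleftrightarrow> (\<exists>r :: nat \<Rightarrow> nat. strict_mono r \<and> (z \<circ> r) \<longlonglongrightarrow> x)"

text \<open>Differentiability is required because \<^const>\<open>gradient\<close> is unspecified where it fails.\<close>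

definition stationary_point :: "('a::euclidean_space \<Rightarrow> real) \<Rightarrow> 'a \<Rightarrow> bool" where
  "stationary_point F x \<longleftrightarrow> F differentiable (at x) \<and> gradient F x = 0"

end

theory Submission
  imports Defs
begin

text \<open>
  The descent lemma for \<open>F\<close>, with the error term \<open>t (\<nabla>F - g) \<bullet> s\<close> split by Young's inequality
  (this is what turns \<open>L\<close> into \<open>L' = L + 1\<close>), gives
  \<open>F (z (k+1)) \<le> F (z k) - q (t k) |g k|\<^sup>2 / 2\<close> with \<open>q t = 2 c1 t - \<beta>\<^sup>2 - L' c2\<^sup>2 t\<^sup>2\<close>.
  The roots of \<open>q\<close> are \<open>t1\<close> and \<open>t2\<close>, so \<open>q (t k) \<ge> L' c2\<^sup>2 \<gamma>\<^sup>2 > 0\<close>.  Hence \<open>F (z k)\<close> decreases,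
  converges because it is bounded below, and its decrements, which dominate a positive multiple of
  \<open>|g k|\<^sup>2\<close>, tend to zero.
\<close>

text \<open>Subtract the linear and quadratic terms from \<open>F\<close> along the line through
  \<open>x\<close> in direction \<open>d\<close>. By Cauchy-Schwarz and the Lipschitz bound, the
  resulting \<open>\<phi>\<close> has derivative at most 0 on [0,1], and comparing its endpoint
  values gives the claim without integration.\<close>

lemma L_smooth_quadratic_upper_bound:
  fixes F :: "'a::euclidean_space \<Rightarrow> real"
  assumes "L_smooth L F"
  shows "F (x + d) \<le> F x + gradient F x \<bullet> d + L / 2 * (norm d)\<^sup>2"
proof -
  have diff: "F differentiable (at y)"
    and lip: "norm (gradient F y - gradient F w) \<le> L * norm (y - w)" for y w
    using assms by (auto simp: L_smooth_def)
  define \<phi> where "\<phi> u = F (x + u *\<^sub>R d) - u * (gradient F x \<bullet> d) - L / 2 * u\<^sup>2 * (norm d)\<^sup>2" for u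
  define \<phi>' where "\<phi>' u = gradient F (x + u *\<^sub>R d) \<bullet> d - gradient F x \<bullet> d - L * u * (norm d)\<^sup>2" for u
  have deriv: "(\<phi> has_real_derivative \<phi>' u) (at u)" for u
  proof -
    have "(F has_derivative (\<lambda>h. h \<bullet> gradient F (x + u *\<^sub>R d))) (at (x + u *\<^sub>R d))"
      using GDERIV_gradient[OF diff] by (simp add: gderiv_def)
    moreover have "((\<lambda>v. x + v *\<^sub>R d) has_derivative (\<lambda>h. h *\<^sub>R d)) (at u)"
      by (auto intro!: derivative_eq_intros)
    ultimately have "((\<lambda>v. F (x + v *\<^sub>R d)) has_derivative
        (\<lambda>h. (h *\<^sub>R d) \<bullet> gradient F (x + u *\<^sub>R d))) (at u)"
      by (rule has_derivative_compose[rotated])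
    then have "((\<lambda>v. F (x + v *\<^sub>R d)) has_real_derivative gradient F (x + u *\<^sub>R d) \<bullet> d) (at u)"
      by (simp add: has_field_derivative_def inner_commute mult_commute_abs)
    then show ?thesis
      unfolding \<phi>_def \<phi>'_def by (auto intro!: derivative_eq_intros)
  qed
  \<comment> \<open>The sign of \<open>u\<close> matters because the Lipschitz bound produces
    \<open>\<bar>u\<bar>\<close>, while \<open>\<phi>'\<close> contains \<open>u\<close>.\<close>
  have nonpos: "\<phi>' u \<le> 0" if "0 \<le> u" for u
  proof -
    have "(gradient F (x + u *\<^sub>R d) - gradient F x) \<bullet> d
        \<le> norm (gradient F (x + u *\<^sub>R d) - gradient F x) * norm d"
      by (rule norm_cauchy_schwarz)
    also have "\<dots> \<le> (L * norm (u *\<^sub>R d)) * norm d"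
      using lip[of "x + u *\<^sub>R d" x] by (intro mult_right_mono) auto
    also have "\<dots> = L * u * (norm d)\<^sup>2"
      using that by (simp add: power2_eq_square)
    finally show ?thesis
      by (simp add: \<phi>'_def inner_diff_left)
  qed
  have "\<phi> 1 \<le> \<phi> 0"
    using deriv nonpos by (intro DERIV_nonpos_imp_nonincreasing[of 0 1 \<phi>]) auto
  then show ?thesis by (simp add: \<phi>_def)
qed

lemma L_smooth_continuous_gradient:
  fixes F :: "'a::euclidean_space \<Rightarrow> real"
  assumes "L_smooth L F"
  shows "isCont (gradient F) x"
proof -
  have "(\<lambda>y. gradient F y - gradient F x) \<midarrow>x\<rightarrow> 0"
  proof (rule Lim_null_comparison)
    show "\<forall>\<^sub>F y in at x. norm (gradient F y - gradient F x) \<le> L * norm (y - x)"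
      using assms by (simp add: L_smooth_def)
    have "(\<lambda>y. L * norm (y - x)) \<midarrow>x\<rightarrow> L * norm (x - x)"
      by (intro tendsto_intros)
    then show "(\<lambda>y. L * norm (y - x)) \<midarrow>x\<rightarrow> 0" by simp
  qed
  then show ?thesis
    by (simp add: isCont_def LIM_zero_iff)
qed

lemma inexact_gradient_step_decrease:
  fixes F :: "'a::euclidean_space \<Rightarrow> real"
  assumes smooth: "L_smooth L F"
    and "0 \<le> t"
    and descent: "c1 * (norm g)\<^sup>2 \<le> - (g \<bullet> s)"
    and dir_bound: "norm s \<le> c2 * norm g"
    and grad_error: "norm (g - gradient F x) \<le> \<beta> * norm g"
  shows "F (x + t *\<^sub>R s)
    \<le> F x - (2 * c1 * t - \<beta>\<^sup>2 - (L + 1) * c2\<^sup>2 * t\<^sup>2) / 2 * (norm g)\<^sup>2"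
proof -
  define e where "e = gradient F x - g"
  \<comment> \<open>Keeping \<open>t\<close> with \<open>s\<close> leaves the error term free of
    \<open>t\<close>, hence the constant \<open>\<beta>\<^sup>2\<close> in the result, and gives the
    other term the shape of the smoothness term, so that 1/2 and L/2 add up to (L + 1)/2.\<close>
  have "0 \<le> (norm (e - t *\<^sub>R s))\<^sup>2" by simp
  then have young: "t * (e \<bullet> s) \<le> (norm e)\<^sup>2 / 2 + t\<^sup>2 * (norm s)\<^sup>2 / 2"
    unfolding power2_norm_eq_inner by (simp add: inner_diff inner_commute power2_eq_square)
  have "(norm e)\<^sup>2 \<le> (\<beta> * norm g)\<^sup>2"
    using grad_error by (intro power_mono) (auto simp: e_def norm_minus_commute)
  then have err: "(norm e)\<^sup>2 \<le> \<beta>\<^sup>2 * (norm g)\<^sup>2" by (simp add: power_mult_distrib)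
  have "(norm s)\<^sup>2 \<le> (c2 * norm g)\<^sup>2"
    using dir_bound by (intro power_mono) auto
  then have "(L + 1) / 2 * t\<^sup>2 * (norm s)\<^sup>2 \<le> (L + 1) / 2 * t\<^sup>2 * (c2\<^sup>2 * (norm g)\<^sup>2)"
    using smooth by (intro mult_left_mono) (auto simp: L_smooth_def power_mult_distrib)
  moreover have "t * (g \<bullet> s) \<le> t * (- (c1 * (norm g)\<^sup>2))"
    using descent \<open>0 \<le> t\<close> by (intro mult_left_mono) auto
  \<comment> \<open>The quadratic bound with d = t s, its linear term split by
    \<open>gradient F x = g + e\<close>.\<close>
  moreover have "F (x + t *\<^sub>R s) \<le> F x + t * (g \<bullet> s) + t * (e \<bullet> s) + L / 2 * t\<^sup>2 * (norm s)\<^sup>2"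
    using L_smooth_quadratic_upper_bound[OF smooth, of x "t *\<^sub>R s"]
    by (simp add: e_def inner_diff_left power_mult_distrib algebra_simps)
  ultimately show ?thesis
    using young err by (simp add: algebra_simps add_divide_distrib diff_divide_distrib)
qed

text \<open>Monotone convergence gives a limit, which the shifted sequence shares, so the two limits
  cancel.\<close>

lemma decreasing_bdd_below_decrement_tendsto_0:
  fixes a :: "nat \<Rightarrow> real"
  assumes "\<And>k. a (Suc k) \<le> a k" and "bdd_below (range a)"
  shows "(\<lambda>k. a k - a (Suc k)) \<longlonglongrightarrow> 0"
proof -
  have "decseq a" using assms(1) by (rule decseq_SucI)
  moreover obtain B where "\<forall>k. B \<le> a k"
    using assms(2) by (auto simp: bdd_below_def)
  ultimately obtain l where "a \<longlonglongrightarrow> l" by (rule decseq_convergent)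
  then show ?thesis
    using tendsto_diff[OF _ LIMSEQ_Suc] by fastforce
qed

theorem theorem4p3:
  fixes F :: "real ^ 'm \<Rightarrow> real"
    and z s g :: "nat \<Rightarrow> real ^ 'm"
    and t \<delta> :: "nat \<Rightarrow> real"
    and L L' c1 c2 \<beta> \<Delta> t1 t2 \<gamma> :: real
  assumes smooth: "L_smooth L F"
    and bounded_below: "bdd_below (range F)"
    and L'_eq: "L' = L + 1"
    and c1_pos: "c1 > 0"
    and c2_pos: "c2 > 0"
    and step: "\<And>k. z (Suc k) = z k + t k *\<^sub>R s k"
    and t_pos: "\<And>k. t k > 0"
    and descent: "\<And>k. c1 * (norm (g k))\<^sup>2 \<le> - (g k \<bullet> s k)"
    and dir_bound: "\<And>k. norm (s k) \<le> c2 * norm (g k)"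
    and \<beta>_range: "\<beta> \<in> {0..<1 / sqrt L' * (c1 / c2)}"
    and \<delta>_nonneg: "\<And>k. \<delta> k \<ge> 0"
    and grad_error: "\<And>k. norm (g k - gradient F (z k)) \<le> \<delta> k"
    and \<delta>_bound: "\<And>k. \<delta> k \<le> \<beta> * norm (g k)"
    and \<Delta>_eq: "\<Delta> = c1\<^sup>2 - L' * c2\<^sup>2 * \<beta>\<^sup>2"
    and t1_eq: "t1 = (c1 - sqrt \<Delta>) / (c2\<^sup>2 * L')"
    and t2_eq: "t2 = (c1 + sqrt \<Delta>) / (c2\<^sup>2 * L')"
    and \<gamma>_range: "\<gamma> \<in> {0<..(t2 - t1) / 2}"
    and t_range: "\<And>k. t k \<in> {t1 + \<gamma>..t2 - \<gamma>}"
  shows "(\<forall>k. F (z (Suc k)) \<le> F (z k))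
    \<and> (g \<longlonglongrightarrow> 0 \<and> (\<lambda>k. gradient F (z k)) \<longlonglongrightarrow> 0)
    \<and> (\<forall>x. seq_limit_point z x \<longrightarrow> stationary_point F x)"
proof -
  have L'_pos: "L' > 0"
    using smooth L'_eq by (simp add: L_smooth_def)
  define A where "A = c2\<^sup>2 * L'"
  have A_pos: "A > 0" using c2_pos L'_pos by (simp add: A_def)
  have \<beta>_nonneg: "\<beta> \<ge> 0" using \<beta>_range by simp
  \<comment> \<open>The square of \<open>sqrt \<Delta>\<close> is
    \<open>\<bar>\<Delta>\<bar>\<close>, so the sign is needed to recover \<open>\<Delta>\<close>
    itself. It follows by squaring the upper bound on \<open>\<beta>\<close>.\<close>
  have "\<Delta> \<ge> 0"
  proof -
    have "sqrt L' * c2 * \<beta> \<le> c1"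
      using \<beta>_range c2_pos L'_pos by (simp add: field_simps)
    then have "(sqrt L' * c2 * \<beta>)\<^sup>2 \<le> c1\<^sup>2"
      using \<beta>_nonneg c2_pos L'_pos by (intro power_mono) auto
    then show ?thesis
      using L'_pos by (simp add: \<Delta>_eq power_mult_distrib)
  qed
  \<comment> \<open>Vieta's formulas for the roots \<open>t1\<close> and \<open>t2\<close>: their
    sum and product turn A (t - t1) (t2 - t) into the quadratic of the descent estimate, whose
    leading coefficient is -A.\<close>
  have At1: "A * t1 = c1 - sqrt \<Delta>" and At2: "A * t2 = c1 + sqrt \<Delta>"
    using c2_pos L'_pos by (simp_all add: t1_eq t2_eq A_def)
  then have t12_sum: "A * (t1 + t2) = 2 * c1"
    by (simp add: distrib_left)
  have t12_prod: "A * (t1 * t2) = \<beta>\<^sup>2"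
  proof -
    have "(A * t1) * (A * t2) = c1\<^sup>2 - (sqrt \<Delta>)\<^sup>2"
      unfolding At1 At2 by (simp add: power2_eq_square algebra_simps)
    also have "\<dots> = A * \<beta>\<^sup>2"
      using \<open>\<Delta> \<ge> 0\<close> by (simp add: \<Delta>_eq A_def)
    finally show ?thesis using A_pos by (simp add: mult.left_commute)
  qed
  have q_bound: "A * \<gamma>\<^sup>2 \<le> 2 * c1 * t k - \<beta>\<^sup>2 - (L + 1) * c2\<^sup>2 * (t k)\<^sup>2" for k
  proof -
    \<comment> \<open>The step size lies between the roots at distance at least
      \<open>\<gamma>\<close> from each, so both factors are at least
      \<open>\<gamma>\<close>.\<close>
    have "\<gamma> * \<gamma> \<le> (t k - t1) * (t2 - t k)"
      using t_range[of k] \<gamma>_range by (intro mult_mono) auto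
    then have "A * \<gamma>\<^sup>2 \<le> A * ((t k - t1) * (t2 - t k))"
      using A_pos by (simp add: power2_eq_square)
    also have "\<dots> = A * (t1 + t2) * t k - A * (t1 * t2) - A * (t k)\<^sup>2"
      by (simp add: algebra_simps power2_eq_square)
    also have "\<dots> = 2 * c1 * t k - \<beta>\<^sup>2 - (L + 1) * c2\<^sup>2 * (t k)\<^sup>2"
      unfolding t12_sum t12_prod by (simp add: A_def L'_eq mult.commute)
    finally show ?thesis .
  qed
  have rel_error: "norm (g k - gradient F (z k)) \<le> \<beta> * norm (g k)" for k
    using grad_error \<delta>_bound by (rule order_trans)
  \<comment> \<open>A decrease constant independent of \<open>k\<close>; this uniformity allows
    decrements tending to 0 to force \<open>norm (g k)\<close> to 0.\<close>
  define C where "C = A * \<gamma>\<^sup>2 / 2"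
  have C_pos: "C > 0" using A_pos \<gamma>_range by (simp add: C_def)
  have decrease: "C * (norm (g k))\<^sup>2 \<le> F (z k) - F (z (Suc k))" for k
  proof -
    have "C * (norm (g k))\<^sup>2
        \<le> (2 * c1 * t k - \<beta>\<^sup>2 - (L + 1) * c2\<^sup>2 * (t k)\<^sup>2) / 2 * (norm (g k))\<^sup>2"
      unfolding C_def using q_bound[of k] by (intro mult_right_mono divide_right_mono) auto
    also have "\<dots> \<le> F (z k) - F (z (Suc k))"
      using inexact_gradient_step_decrease[OF smooth less_imp_le[OF t_pos[of k]] descent[of k]
          dir_bound[of k] rel_error[of k]]
      by (simp add: step)
    finally show ?thesis .
  qed
  have mono: "F (z (Suc k)) \<le> F (z k)" for k
    using decrease[of k] C_pos by (smt (verit) mult_nonneg_nonneg zero_le_power2)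
  have "bdd_below (range (\<lambda>k. F (z k)))"
    using bounded_below by (rule bdd_below_mono) auto
  with mono have "(\<lambda>k. F (z k) - F (z (Suc k))) \<longlonglongrightarrow> 0"
    by (rule decreasing_bdd_below_decrement_tendsto_0)
  then have "(\<lambda>k. (F (z k) - F (z (Suc k))) / C) \<longlonglongrightarrow> 0"
    by (rule tendsto_divide_zero)
  moreover have "norm ((norm (g k))\<^sup>2) \<le> (F (z k) - F (z (Suc k))) / C" for k
    using decrease[of k] C_pos by (simp add: field_simps)
  ultimately have "(\<lambda>k. (norm (g k))\<^sup>2) \<longlonglongrightarrow> 0"
    by (rule Lim_null_comparison[OF always_eventually[OF allI], rotated])
  then have g_lim: "g \<longlonglongrightarrow> 0"
    by (simp add: tendsto_norm_zero_iff)
  \<comment> \<open>The relative error bound makes the gradient error vanish together with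
    \<open>g\<close>; subtracting it from \<open>g\<close> yields the exact gradients.\<close>
  have "(\<lambda>k. g k - gradient F (z k)) \<longlonglongrightarrow> 0"
  proof (rule Lim_null_comparison)
    show "\<forall>\<^sub>F k in sequentially. norm (g k - gradient F (z k)) \<le> \<beta> * norm (g k)"
      using rel_error by simp
    show "(\<lambda>k. \<beta> * norm (g k)) \<longlonglongrightarrow> 0"
      using g_lim by (intro tendsto_mult_right_zero tendsto_norm_zero)
  qed
  from tendsto_diff[OF g_lim this] have grad_lim: "(\<lambda>k. gradient F (z k)) \<longlonglongrightarrow> 0"
    by simp
  have "stationary_point F x" if "seq_limit_point z x" for x
  proof -
    from that obtain r where r: "strict_mono r" "(z \<circ> r) \<longlonglongrightarrow> x"
      by (auto simp: seq_limit_point_def)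
    \<comment> \<open>Along the subsequence the gradients have two limits,
      \<open>gradient F x\<close> by continuity and 0 from the whole sequence, and these must
      agree.\<close>
    have "(\<lambda>k. gradient F ((z \<circ> r) k)) \<longlonglongrightarrow> gradient F x"
      using L_smooth_continuous_gradient[OF smooth] r(2) by (rule isCont_tendsto_compose)
    moreover have "(\<lambda>k. gradient F ((z \<circ> r) k)) \<longlonglongrightarrow> 0"
      using LIMSEQ_subseq_LIMSEQ[OF grad_lim r(1)] by (simp add: o_def)
    ultimately have "gradient F x = 0" by (rule LIMSEQ_unique)
    then show ?thesis
      using smooth by (simp add: stationary_point_def L_smooth_def)
  qed
  with mono g_lim grad_lim show ?thesis by blast
qed

end
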